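(* Let $\mathcal H_K$ and $\mathcal H_0$ be Hilbert spaces with inner products $(\cdot,\cdot)_K$, $(\cdot,\cdot)_0$ and norms $\|\cdot\|_K$, $\|\cdot\|_0$, and let $E:\mathcal H_K\to\mathcal H_0$ be a continuous linear embedding with Hilbert space adjoint $E^*:\mathcal H_0\to\mathcal H_K$. Let $\Pi:\mathcal H_K\to\mathcal H_K$ be the orthogonal projector onto a closed subspace of $\mathcal H_K$, and let $\epsilon\ge 0$ be such that $$\|E(f-\Pi f)\|_0\le \epsilon\,\|f-\Pi f\|_K\quad\text{for all } f\in\mathcal H_K .$$ Then for every $f$ in the subspace $E^*(\mathcal H_0)$ of $\mathcal H_K$ and every $v_f\in\mathcal H_0$ with $f=E^*v_f$, $$\|E(f-\Pi f)\|_0\le \epsilon^2\,\|v_f\|_0 .$$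
   Context: The adjoint is characterized by $(E^*v,g)_K=(v,Eg)_0$ for all $v\in\mathcal H_0$, $g\in\mathcal H_K$. An embedding is an injective linear map. *)

theory Defs
  imports "HOL-Analysis.Analysis"
begin

text \<open>
  The scalar field of a Hilbert space is real or complex. The class below abstracts over the
  two, with \<open>scalar_cnj\<close> being the identity on the reals and complex conjugation on the complex
  numbers.
\<close>

class hilbert_scalar = real_normed_field +
  fixes scalar_cnj :: "'a \<Rightarrow> 'a"
  assumes scalar_cnj_add: "scalar_cnj (x + y) = scalar_cnj x + scalar_cnj y"
    and scalar_cnj_mult: "scalar_cnj (x * y) = scalar_cnj x * scalar_cnj y"
    and scalar_cnj_cnj: "scalar_cnj (scalar_cnj x) = x"
    and scalar_cnj_scaleR_one: "scalar_cnj (r *\<^sub>R 1) = r *\<^sub>R 1"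
    and mult_scalar_cnj_self: "x * scalar_cnj x = (norm x)\<^sup>2 *\<^sub>R 1"

instantiation real :: hilbert_scalar
begin

definition scalar_cnj_real :: "real \<Rightarrow> real"
  where "scalar_cnj_real x = x"

instance
  by standard (simp_all add: scalar_cnj_real_def power2_eq_square)

end

instantiation complex :: hilbert_scalar
begin

definition scalar_cnj_complex :: "complex \<Rightarrow> complex"
  where "scalar_cnj_complex = cnj"

instance
  by standard (simp_all add: scalar_cnj_complex_def complex_norm_square scaleR_conv_of_real del: of_real_power)

end

text \<open>
  The norm, the topology and completeness are those of the type class \<open>banach\<close>; the locale adds
  scalar multiplication by the full scalar field, extending the real one of the class, and an
  inner product, linear in its first argument, that induces the norm of the class.
\<close>

locale hilbert_space = vector_space scale
  for scale :: "'s::hilbert_scalar \<Rightarrow> 'a::banach \<Rightarrow> 'a" +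
  fixes ip :: "'a \<Rightarrow> 'a \<Rightarrow> 's"
  assumes scale_of_real: "scale (of_real r) x = r *\<^sub>R x"
    and ip_add_left: "ip (x + y) z = ip x z + ip y z"
    and ip_scale_left: "ip (scale c x) y = c * ip x y"
    and ip_commute: "ip y x = scalar_cnj (ip x y)"
    and ip_self: "ip x x = of_real ((norm x)\<^sup>2)"

lemma hilbert_space_real:
  "hilbert_space (scaleR :: real \<Rightarrow> 'a::{real_inner,banach} \<Rightarrow> 'a) inner"
  by unfold_locales
    (simp_all add: algebra_simps inner_commute scalar_cnj_real_def dot_square_norm)

lemma hilbert_space_complex:
  "hilbert_space ((*) :: complex \<Rightarrow> complex \<Rightarrow> complex) (\<lambda>x y. x * cnj y)"
  by unfold_locales
    (simp_all add: algebra_simps scalar_cnj_complex_def complex_norm_square scaleR_conv_of_real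
      del: of_real_power)

definition is_hilbert_adjoint ::
    "('a \<Rightarrow> 'a \<Rightarrow> 's) \<Rightarrow> ('b \<Rightarrow> 'b \<Rightarrow> 's) \<Rightarrow> ('a \<Rightarrow> 'b) \<Rightarrow> ('b \<Rightarrow> 'a) \<Rightarrow> bool"
  where "is_hilbert_adjoint ipA ipB T T' \<longleftrightarrow> (\<forall>v g. ipA (T' v) g = ipB v (T g))"

definition is_orthogonal_projector ::
    "('a \<Rightarrow> 'a \<Rightarrow> 's::zero) \<Rightarrow> 'a::ab_group_add set \<Rightarrow> ('a \<Rightarrow> 'a) \<Rightarrow> bool"
  where "is_orthogonal_projector ip V P \<longleftrightarrow>
    (\<forall>f. P f \<in> V \<and> (\<forall>g\<in>V. ip (f - P f) g = 0))"

end

theory Submission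
  imports Defs
begin

text \<open>
  The estimate is a duality argument, and \<open>\<epsilon>\<close> enters it twice. Let \<open>r = f - P f\<close>. The residual
  \<open>r\<close> is orthogonal to \<open>P f\<close>, so \<open>(r, r) = (f, r)\<close>. If \<open>f = E\<^sup>* v\<close>, the adjoint moves this
  pairing to the target space, \<open>(f, r) = (v, E r)\<close>, where the Cauchy-Schwarz inequality and the
  assumed bound on \<open>E r\<close> give \<open>\<parallel>r\<parallel>\<^sup>2 \<le> \<parallel>v\<parallel> \<cdot> \<epsilon> \<parallel>r\<parallel>\<close>. Thus \<open>\<parallel>r\<parallel> \<le> \<epsilon> \<parallel>v\<parallel>\<close>
  (lemma \<open>norm_residual_le_dual_norm\<close>), and applying the assumed bound once more yields
  \<open>\<parallel>E r\<parallel> \<le> \<epsilon> \<parallel>r\<parallel> \<le> \<epsilon>\<^sup>2 \<parallel>v\<parallel>\<close>.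
\<close>

lemma scalar_cnj_of_real: "scalar_cnj (of_real r :: 's::hilbert_scalar) = of_real r"
  by (simp add: of_real_def scalar_cnj_scaleR_one)

lemma scalar_cnj_zero: "scalar_cnj (0 :: 's::hilbert_scalar) = 0"
  using scalar_cnj_of_real[of 0] by simp

context hilbert_space
begin

lemma ip_diff_left: "ip (x - y) z = ip x z - ip y z"
  using ip_add_left[of "x - y" y z] by (simp add: algebra_simps)

lemma ip_eq_zero_commute: "ip x y = 0 \<Longrightarrow> ip y x = 0"
  using ip_commute[of y x] by (simp add: scalar_cnj_zero)

text \<open>
  For \<open>y \<noteq> 0\<close>, the squared norm of the component of \<open>x\<close> orthogonal to \<open>y\<close> is
  \<open>\<parallel>x\<parallel>\<^sup>2 - \<bar>(x, y)\<bar>\<^sup>2 / \<parallel>y\<parallel>\<^sup>2\<close>, and it is nonnegative.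
\<close>

lemma Cauchy_Schwarz: "norm (ip x y) \<le> norm x * norm y"
proof (cases "y = 0")
  case True
  then show ?thesis
    using ip_diff_left[of 0 0 x] ip_eq_zero_commute[of 0 x] by simp
next
  case False
  define c where "c = ip x y / of_real ((norm y)\<^sup>2)"
  define z where "z = x - scale c y"
  have zy: "ip z y = 0"
    using False by (simp add: z_def c_def ip_diff_left ip_scale_left ip_self)
  have "c * ip y x = of_real ((norm (ip x y))\<^sup>2 / (norm y)\<^sup>2)"
    using mult_scalar_cnj_self[of "ip x y"] ip_commute[of y x]
    by (simp add: c_def of_real_def[symmetric])
  then have zx: "ip z x = of_real ((norm x)\<^sup>2 - (norm (ip x y))\<^sup>2 / (norm y)\<^sup>2)"
    by (simp add: z_def ip_diff_left ip_scale_left ip_self)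
  have "of_real ((norm z)\<^sup>2) = ip z z"
    by (simp add: ip_self)
  also have "\<dots> = ip x z - c * ip y z"
    by (subst (1) z_def) (simp add: ip_diff_left ip_scale_left)
  also have "\<dots> = scalar_cnj (ip z x)"
    using ip_eq_zero_commute[OF zy] ip_commute[of x z] by simp
  also have "\<dots> = of_real ((norm x)\<^sup>2 - (norm (ip x y))\<^sup>2 / (norm y)\<^sup>2)"
    unfolding zx by (rule scalar_cnj_of_real)
  finally have "(norm z)\<^sup>2 = (norm x)\<^sup>2 - (norm (ip x y))\<^sup>2 / (norm y)\<^sup>2"
    by (simp only: of_real_eq_iff)
  then have "(norm (ip x y))\<^sup>2 / (norm y)\<^sup>2 \<le> (norm x)\<^sup>2"
    using zero_le_power2[of "norm z"] by linarith
  then have "(norm (ip x y))\<^sup>2 \<le> (norm x * norm y)\<^sup>2"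
    using False by (simp add: field_simps power_mult_distrib)
  then show ?thesis
    by (rule power2_le_imp_le) simp
qed

lemma ip_residual_self:
  assumes "is_orthogonal_projector ip V P"
  shows "ip f (f - P f) = of_real ((norm (f - P f))\<^sup>2)"
proof -
  have "ip (f - P f) (P f) = 0"
    using assms by (simp add: is_orthogonal_projector_def)
  then have "ip (P f) (f - P f) = 0"
    by (rule ip_eq_zero_commute)
  then show ?thesis
    using ip_self[of "f - P f"] by (simp add: ip_diff_left)
qed

end

text \<open>
  The duality step, as in the Aubin-Nitsche argument: pairing the residual \<open>r\<close> with \<open>Estar v\<close>
  produces its own squared norm, while the adjoint turns that pairing into one against \<open>E r\<close>,
  which is small by assumption. One factor \<open>norm r\<close> then cancels.
\<close>

lemma norm_residual_le_dual_norm: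
  assumes "hilbert_space scaleK ipK"
    and "hilbert_space scale0 ip0"
    and adj: "is_hilbert_adjoint ipK ip0 E Estar"
    and proj: "is_orthogonal_projector ipK V P"
    and bound: "norm (E (Estar v - P (Estar v))) \<le> \<epsilon> * norm (Estar v - P (Estar v))"
    and "\<epsilon> \<ge> 0"
  shows "norm (Estar v - P (Estar v)) \<le> \<epsilon> * norm v"
proof -
  interpret K: hilbert_space scaleK ipK by fact
  interpret H: hilbert_space scale0 ip0 by fact
  define r where "r = Estar v - P (Estar v)"
  have "of_real ((norm r)\<^sup>2) = ipK (Estar v) r"
    unfolding r_def using K.ip_residual_self[OF proj] by simp
  also have "\<dots> = ip0 v (E r)"
    using adj by (simp add: is_hilbert_adjoint_def)
  finally have "norm (of_real ((norm r)\<^sup>2) :: 'a) = norm (ip0 v (E r))"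
    by simp
  then have "norm r * norm r = norm (ip0 v (E r))"
    by (simp add: power2_eq_square norm_mult)
  also have "\<dots> \<le> norm v * norm (E r)"
    by (rule H.Cauchy_Schwarz)
  also have "\<dots> \<le> norm v * (\<epsilon> * norm r)"
    using bound by (intro mult_left_mono) (simp_all add: r_def)
  finally have "norm r * norm r \<le> (\<epsilon> * norm v) * norm r"
    by (simp add: mult_ac)
  then have "norm r \<le> \<epsilon> * norm v"
    using \<open>\<epsilon> \<ge> 0\<close> by (cases "r = 0") auto
  then show ?thesis
    by (simp add: r_def)
qed

theorem theorem1:
  fixes scaleK :: "'s::hilbert_scalar \<Rightarrow> 'k::banach \<Rightarrow> 'k"
    and scale0 :: "'s \<Rightarrow> 'h::banach \<Rightarrow> 'h"
    and ipK :: "'k \<Rightarrow> 'k \<Rightarrow> 's"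
    and ip0 :: "'h \<Rightarrow> 'h \<Rightarrow> 's"
    and E :: "'k \<Rightarrow> 'h"
    and Estar :: "'h \<Rightarrow> 'k"
    and V :: "'k set"
    and P :: "'k \<Rightarrow> 'k"
    and \<epsilon> :: real
  assumes "hilbert_space scaleK ipK"
    and "hilbert_space scale0 ip0"
    and "Vector_Spaces.linear scaleK scale0 E"
    and "continuous_on UNIV E"
    and "inj E"
    and "is_hilbert_adjoint ipK ip0 E Estar"
    and "module.subspace scaleK V"
    and "closed V"
    and "is_orthogonal_projector ipK V P"
    and "\<epsilon> \<ge> 0"
    and "\<And>f. norm (E (f - P f)) \<le> \<epsilon> * norm (f - P f)"
  shows "\<forall>f \<in> range Estar. \<forall>v. f = Estar v \<longrightarrow> norm (E (f - P f)) \<le> \<epsilon>\<^sup>2 * norm v"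
proof (intro ballI allI impI)
  fix f v
  assume f: "f = Estar v"
  have "norm (f - P f) \<le> \<epsilon> * norm v"
    unfolding f using assms(1,2,6,9) assms(11)[of "Estar v"] assms(10)
    by (rule norm_residual_le_dual_norm)
  then have "\<epsilon> * norm (f - P f) \<le> \<epsilon> * (\<epsilon> * norm v)"
    using assms(10) by (rule mult_left_mono)
  with assms(11)[of f] show "norm (E (f - P f)) \<le> \<epsilon>\<^sup>2 * norm v"
    by (simp add: power2_eq_square mult.assoc)
qed

end
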